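(* Let $A=\{a_1<\dots<a_m\}$, $B=\{b_1<\dots<b_n\}$, $O=A\times B$, $X$ the set of monotone non-decreasing maps $A\to B$, $Y$ the set of monotone non-decreasing maps $B\to A$, and $G(x,y)=\{(a,b)\in O: x(a)=b,\ y(b)=a\}$. Let $W\subseteq O$. If for each $y\in Y$ there exists $x\in X$ such that $W\cap G(x,y)\neq\emptyset$, then there exists $x\in X$ such that $G(x,y)\subseteq W$ for every $y\in Y$. *)

theory Defs
  imports Main "HOL-Library.FuncSet"
begin

(* Maps are extensional (undefined outside the domain), so that each map
   A \<rightarrow> B is represented by exactly one HOL function. *)
definition mono_maps :: "'a::linorder set \<Rightarrow> 'b::linorder set \<Rightarrow> ('a \<Rightarrow> 'b) set" where
  "mono_maps A B = {f \<in> A \<rightarrow>\<^sub>E B. mono_on A f}"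

definition deals :: "'a set \<Rightarrow> 'b set \<Rightarrow> ('a \<Rightarrow> 'b) \<Rightarrow> ('b \<Rightarrow> 'a) \<Rightarrow> ('a \<times> 'b) set" where
  "deals A B x y = {(a, b) \<in> A \<times> B. x a = b \<and> y b = a}"

end

theory Submission
  imports Defs
begin

text \<open>
  Seen through its graph, the hypothesis says that no monotone \<open>B \<rightarrow> A\<close> avoids \<open>W\<close>, and it is
  enough to find a monotone \<open>A \<rightarrow> B\<close> inside \<open>W\<close>. Choose such a map greedily, from the least
  element of \<open>A\<close> upwards, taking at each \<open>a\<close> the least admissible value. If the choice gets stuck,
  the cells passed over by the greedy choice, together with the column where it got stuck,
  contain the graph of a monotone map \<open>B \<rightarrow> A\<close> that avoids \<open>W\<close>.
\<close>

lemma mono_graph_dichotomy: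
  fixes A :: "'a::linorder set" and B :: "'b::linorder set"
  assumes "finite A" and "finite B"
  shows "(\<exists>x \<in> A \<rightarrow> B. mono_on A x \<and> (\<forall>a\<in>A. (a, x a) \<in> W)) \<or>
         (\<exists>y \<in> B \<rightarrow> A. mono_on B y \<and> (\<forall>b\<in>B. (y b, b) \<notin> W))"
  using assms
proof (induction A arbitrary: B rule: finite_linorder_min_induct)
  case empty
  then show ?case by (auto simp: mono_on_def)
next
  case (insert a A)
  define S where "S = {b \<in> B. (a, b) \<in> W}"
  show ?case
  proof (cases "S = {}")
    case True
    then have "(\<lambda>_. a) \<in> B \<rightarrow> insert a A" "mono_on B (\<lambda>_. a)" "\<forall>b\<in>B. (a, b) \<notin> W"
      by (auto simp: S_def mono_on_def)
    then show ?thesis by blast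
  next
    case False
    have "finite S" using insert.prems by (simp add: S_def)
    define m where "m = Min S"
    have m: "m \<in> B" "(a, m) \<in> W"
      using Min_in[OF \<open>finite S\<close> False] by (auto simp: m_def S_def)
    have below_m: "(a, b) \<notin> W" if "b \<in> B" "b < m" for b
      using that Min_le[OF \<open>finite S\<close>, of b] by (auto simp: m_def S_def)
    have "a \<notin> A" using insert.hyps by auto
    \<comment> \<open>Once \<open>a\<close> goes to \<open>m\<close>, monotonicity leaves exactly
      these values to the rest of \<open>A\<close>; hence the induction is over arbitrary
      \<open>B\<close>.\<close>
    define B' where "B' = {b \<in> B. m \<le> b}"
    have "finite B'" using insert.prems by (simp add: B'_def)
    from insert.IH[OF this] show ?thesis
    proof (elim disjE bexE conjE)
      fix x assume x: "x \<in> A \<rightarrow> B'" "mono_on A x" "\<forall>a\<in>A. (a, x a) \<in> W"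
      have "x(a := m) \<in> insert a A \<rightarrow> B" "\<forall>c\<in>insert a A. (c, (x(a := m)) c) \<in> W"
        using x m by (auto simp: B'_def)
      moreover have "mono_on (insert a A) (x(a := m))"
        using x insert.hyps \<open>a \<notin> A\<close> by (fastforce simp: mono_on_def B'_def)
      ultimately show ?thesis by blast
    next
      fix y assume y: "y \<in> B' \<rightarrow> A" "mono_on B' y" "\<forall>b\<in>B'. (y b, b) \<notin> W"
      \<comment> \<open>Below \<open>m\<close>, column \<open>a\<close> misses \<open>W\<close> by
        minimality of \<open>m\<close>; as \<open>a\<close> lies below all of \<open>A\<close>,
        putting it before \<open>y\<close> keeps monotonicity.\<close>
      define z where "z b = (if b < m then a else y b)" for b
      have y_in: "y b \<in> A" if "b \<in> B" "\<not> b < m" for b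
        using that y(1) by (auto simp: B'_def)
      then have "z \<in> B \<rightarrow> insert a A" by (auto simp: z_def)
      moreover have "\<forall>b\<in>B. (z b, b) \<notin> W"
        using y(3) below_m by (auto simp: B'_def z_def)
      moreover have "mono_on B z"
      proof (rule mono_onI)
        fix r s assume rs: "r \<in> B" "s \<in> B" "r \<le> s"
        show "z r \<le> z s"
        proof (cases "r < m")
          case True
          then show ?thesis
            using y_in[of s] insert.hyps rs by (auto simp: z_def intro: less_imp_le)
        next
          case False
          then show ?thesis
            using rs mono_onD[OF y(2), of r s] by (auto simp: z_def B'_def)
        qed
      qed
      ultimately show ?thesis by blast
    qed
  qed
qed

lemma restrict_in_mono_maps:
  assumes "f \<in> A \<rightarrow> B" and "mono_on A f"
  shows "restrict f A \<in> mono_maps A B"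
  using assms by (auto simp: mono_maps_def mono_on_def)

theorem theorem1:
  fixes A :: "'a::linorder set" and B :: "'b::linorder set" and W :: "('a \<times> 'b) set"
  assumes "finite A" and "finite B"
    and "W \<subseteq> A \<times> B"
    and "\<forall>y \<in> mono_maps B A. \<exists>x \<in> mono_maps A B. W \<inter> deals A B x y \<noteq> {}"
  shows "\<exists>x \<in> mono_maps A B. \<forall>y \<in> mono_maps B A. deals A B x y \<subseteq> W"
  using mono_graph_dichotomy[OF assms(1,2), of W]
proof (elim disjE bexE conjE)
  fix x assume "x \<in> A \<rightarrow> B" "mono_on A x" "\<forall>a\<in>A. (a, x a) \<in> W"
  \<comment> \<open>Every deal lies on the graph of \<open>x\<close>, hence in \<open>W\<close>,
    whatever the other map is.\<close>
  then show ?thesis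
    by (intro bexI[OF _ restrict_in_mono_maps]) (auto simp: deals_def)
next
  fix y assume y: "y \<in> B \<rightarrow> A" "mono_on B y" "\<forall>b\<in>B. (y b, b) \<notin> W"
  \<comment> \<open>A deal also lies on the graph of \<open>y\<close>, which avoids
    \<open>W\<close>, so a deal in \<open>W\<close> is contradictory.\<close>
  with assms(4) restrict_in_mono_maps obtain x
    where "W \<inter> deals A B x (restrict y B) \<noteq> {}" by blast
  with y(3) show ?thesis by (auto simp: deals_def)
qed

end
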